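(* Let $r\geq 3$ and let $\mathcal{G}$, $\mathcal{H}$ and $\Gamma$ be $r$-uniform supertrees, where $\mathcal{G}$ and $\mathcal{H}$ have the same number of vertices. Let $u\in V(\mathcal{G})$ and $v\in V(\mathcal{H})$. If $\varphi(\mathcal{G},x)=\varphi(\mathcal{H},x)$ and $\varphi(\mathcal{G}-u,x)=\varphi(\mathcal{H}-v,x)$, then for every $w\in V(\Gamma)$ we have $\rho(\mathcal{G}(u,w)\Gamma)=\rho(\mathcal{H}(v,w)\Gamma)$ and $ME(\mathcal{G}(u,w)\Gamma)=ME(\mathcal{H}(v,w)\Gamma)$.
   Context: An $r$-uniform supertree is a connected acyclic hypergraph each of whose edges has exactly $r$ vertices. For an $r$-uniform hypergraph $\mathcal{H}$ on $n$ vertices, $m(\mathcal{H},k)$ is the number of sets of $k$ pairwise disjoint edges ($m(\mathcal{H},0)=1$) and the matching polynomial is $\varphi(\mathcal{H},x)=\sum_{k\geq 0}(-1)^k m(\mathcal{H},k)x^{n-kr}$. The matching energy $ME(\mathcal{H})$ is the sum of the absolute values of all roots (with multiplicity) of $\varphi(\mathcal{H},x)$. The adjacency tensor of $\mathcal{H}$ with vertex set $[n]$ is the order-$r$, dimension-$n$ tensor $\mathcal{A}=(a_{i_1\cdots i_r})$ with $a_{i_1\cdots i_r}=1/(r-1)!$ if $\{i_1,\dots,i_r\}$ is an edge and $0$ otherwise; $\lambda\in\mathbb{C}$ is an eigenvalue if there is nonzero $x\in\mathbb{C}^n$ with $\sum_{i_2,\dots,i_r}a_{ii_2\cdots i_r}x_{i_2}\cdots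 x_{i_r}=\lambda x_i^{r-1}$ for all $i$, and the spectral radius $\rho(\mathcal{H})$ is the maximum modulus of the eigenvalues. $\mathcal{H}-u$ is obtained by deleting vertex $u$ and all edges containing it. $\mathcal{G}(u,w)\Gamma$ is obtained from disjoint $\mathcal{G},\Gamma$ by identifying $u\in V(\mathcal{G})$ with $w\in V(\Gamma)$. *)

theory Defs
  imports Complex_Main "HOL-Library.FuncSet" "HOL-Computational_Algebra.Polynomial"
begin

text \<open>A hypergraph is a pair (vertex set, edge set); edges are sets of vertices.\<close>
type_synonym 'a hypergraph = "'a set \<times> 'a set set"

definition verts :: "'a hypergraph \<Rightarrow> 'a set" where "verts H = fst H"
definition edges :: "'a hypergraph \<Rightarrow> 'a set set" where "edges H = snd H"

definition uniform_hg :: "nat \<Rightarrow> 'a hypergraph \<Rightarrow> bool" where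
  "uniform_hg r H \<longleftrightarrow> finite (verts H) \<and> (\<forall>e\<in>edges H. e \<subseteq> verts H \<and> card e = r)"

definition hg_adj :: "'a hypergraph \<Rightarrow> ('a \<times> 'a) set" where
  "hg_adj H = {(x, y). \<exists>e\<in>edges H. x \<in> e \<and> y \<in> e}"

definition hg_connected :: "'a hypergraph \<Rightarrow> bool" where
  "hg_connected H \<longleftrightarrow> verts H \<noteq> {} \<and> (\<forall>x\<in>verts H. \<forall>y\<in>verts H. (x, y) \<in> (hg_adj H)\<^sup>*)"

text \<open>Berge cycle: v_0 e_0 v_1 e_1 ... v_(k-1) e_(k-1) v_0, k >= 2, distinct vertices and edges.\<close>
definition has_berge_cycle :: "'a hypergraph \<Rightarrow> bool" where
  "has_berge_cycle H \<longleftrightarrow> (\<exists>vs es. length vs \<ge> 2 \<and> length es = length vs \<and>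
      distinct vs \<and> distinct es \<and> set es \<subseteq> edges H \<and>
      (\<forall>i < length vs. vs ! i \<in> es ! i \<and> vs ! ((i + 1) mod length vs) \<in> es ! i))"

definition supertree :: "nat \<Rightarrow> 'a hypergraph \<Rightarrow> bool" where
  "supertree r H \<longleftrightarrow> uniform_hg r H \<and> hg_connected H \<and> \<not> has_berge_cycle H"

text \<open>Number of k-matchings.\<close>
definition matchings_num :: "'a hypergraph \<Rightarrow> nat \<Rightarrow> nat" where
  "matchings_num H k = card {M. M \<subseteq> edges H \<and> card M = k \<and>
      (\<forall>e\<in>M. \<forall>f\<in>M. e \<noteq> f \<longrightarrow> e \<inter> f = {})}"

definition matching_poly :: "nat \<Rightarrow> 'a hypergraph \<Rightarrow> real poly" where
  "matching_poly r H = (\<Sum>k \<in> {0..card (verts H) div r}.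
      monom ((-1) ^ k * of_nat (matchings_num H k)) (card (verts H) - k * r))"

text \<open>Sum of absolute values of all complex roots, counted with multiplicity.\<close>
definition root_abs_sum :: "real poly \<Rightarrow> real" where
  "root_abs_sum p = (let q = map_poly complex_of_real p in
      \<Sum>z \<in> {z. poly q z = 0}. of_nat (order z q) * cmod z)"

definition matching_energy :: "nat \<Rightarrow> 'a hypergraph \<Rightarrow> real" where
  "matching_energy r H = root_abs_sum (matching_poly r H)"

text \<open>Adjacency tensor entry a_{i_0 ... i_(r-1)} (index tuple as a function on {..<r}).\<close>
definition adj_tensor :: "nat \<Rightarrow> 'a hypergraph \<Rightarrow> (nat \<Rightarrow> 'a) \<Rightarrow> complex" where
  "adj_tensor r H idx = (if idx ` {..<r} \<in> edges H then 1 / of_nat (fact (r - 1)) else 0)"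

definition tensor_eigenvalue :: "nat \<Rightarrow> 'a hypergraph \<Rightarrow> complex \<Rightarrow> bool" where
  "tensor_eigenvalue r H lam \<longleftrightarrow> (\<exists>x :: 'a \<Rightarrow> complex. (\<exists>i\<in>verts H. x i \<noteq> 0) \<and>
     (\<forall>i\<in>verts H. (\<Sum>g \<in> {1..<r} \<rightarrow>\<^sub>E verts H.
          adj_tensor r H (g(0 := i)) * (\<Prod>k\<in>{1..<r}. x (g k))) = lam * x i ^ (r - 1)))"

definition spectral_radius_hg :: "nat \<Rightarrow> 'a hypergraph \<Rightarrow> real" where
  "spectral_radius_hg r H = Sup {cmod lam | lam. tensor_eigenvalue r H lam}"

definition delete_vertex :: "'a hypergraph \<Rightarrow> 'a \<Rightarrow> 'a hypergraph" where
  "delete_vertex H u = (verts H - {u}, {e \<in> edges H. u \<notin> e})"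

text \<open>Coalescence G(u,w)Gamma: disjoint union (via Inl/Inr) with Inr w identified with Inl u.\<close>
definition coalesce :: "'a hypergraph \<Rightarrow> 'a \<Rightarrow> 'b \<Rightarrow> 'b hypergraph \<Rightarrow> ('a + 'b) hypergraph" where
  "coalesce G u w \<Gamma> = (let f = (\<lambda>x. if x = w then Inl u else Inr x) in
     (Inl ` verts G \<union> Inr ` (verts \<Gamma> - {w}),
      (\<lambda>e. Inl ` e) ` edges G \<union> (\<lambda>e. f ` e) ` edges \<Gamma>))"

end

theory Submission
  imports Defs
begin

text \<open>
  Matchings of a coalescence are pairs of matchings of the two parts that do not both cover the
  glued vertex, so its matching numbers depend only on those of the parts with and without that
  vertex. This gives the matching energies.

  For the spectral radii write \<open>S(E, z)\<close> for the sum of \<open>z\<^bsup>|M|\<^esup>\<close> over the matchings \<open>M\<close> of the edge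
  set \<open>E\<close> of a supertree, and let \<open>a\<close> be the least positive zero of \<open>b \<mapsto> S(E, - b)\<close>. Connectedness
  makes \<open>S(F, - a)\<close> positive for every proper subset \<open>F\<close> of \<open>E\<close>. Because an edge \<open>e\<close> splits the tree
  into branches, the values \<open>S(E - u, - a)\<close> with \<open>u \<in> e\<close> multiply to \<open>a\<^bsup>r-1\<^esup> S(E - e, - a)\<^sup>r\<close>, which
  says that their \<open>r\<close>-th roots form a positive eigenvector with eigenvalue \<open>a\<^bsup>-1/r\<^esup>\<close>. The eigenvalue of
  a positive eigenvector is the spectral radius, so the latter is determined by the matching numbers.
\<close>

section \<open>Matching sums\<close>

text \<open>The ring is left open: at the polynomial variable this is the generating polynomial of
  the matching numbers, at a real number its value. Only edges enter, so isolated vertices have no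
  influence.\<close>

definition matching_sum :: "'a set set \<Rightarrow> 'b::comm_ring_1 \<Rightarrow> 'b" where
  "matching_sum E z = (\<Sum>M | M \<subseteq> E \<and> pairwise disjnt M. z ^ card M)"

lemma matching_sum_empty [simp]: "matching_sum {} z = 1"
  by (simp add: matching_sum_def cong: conj_cong)

text \<open>Deletion recursion: a matching either avoids \<open>e\<close>, or is \<open>e\<close>
  together with a matching of the edges disjoint from \<open>e\<close>.\<close>

lemma matching_sum_insert:
  assumes "finite E" "e \<notin> E"
  shows "matching_sum (insert e E) z = matching_sum E z + z * matching_sum {f \<in> E. disjnt e f} z"
proof -
  let ?A = "{M. M \<subseteq> E \<and> pairwise disjnt M}"
  let ?B = "{M. M \<subseteq> {f \<in> E. disjnt e f} \<and> pairwise disjnt M}"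
  have fin: "finite ?A" "finite ?B"
    using assms(1) by auto
  have split: "{M. M \<subseteq> insert e E \<and> pairwise disjnt M} = ?A \<union> insert e ` ?B" (is "?L = _")
  proof (intro equalityI subsetI)
    fix M assume M: "M \<in> ?L"
    show "M \<in> ?A \<union> insert e ` ?B"
    proof (cases "e \<in> M")
      case True
      then have "M = insert e (M - {e})" by auto
      moreover have "M - {e} \<in> ?B"
        using M True by (auto simp: pairwise_def)
      ultimately show ?thesis by blast
    qed (use M in auto)
  next
    fix M assume "M \<in> ?A \<union> insert e ` ?B"
    then show "M \<in> ?L" by (fastforce simp: pairwise_insert disjnt_sym)
  qed
  have "?A \<inter> insert e ` ?B = {}" using assms(2) by auto
  moreover have inj: "inj_on (insert e) ?B"
    using assms(2) by (intro inj_onI, subst (asm) insert_ident) auto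
  ultimately have "matching_sum (insert e E) z = matching_sum E z + (\<Sum>M\<in>?B. z ^ card (insert e M))"
    unfolding matching_sum_def split using fin
    by (subst sum.union_disjoint) (auto simp: sum.reindex)
  also have "(\<Sum>M\<in>?B. z ^ card (insert e M)) = (\<Sum>M\<in>?B. z * z ^ card M)"
  proof (rule sum.cong)
    fix M assume "M \<in> ?B"
    then have "finite M" "e \<notin> M" using assms finite_subset[of M E] by auto
    then show "z ^ card (insert e M) = z * z ^ card M" by simp
  qed simp
  finally show ?thesis by (simp add: matching_sum_def sum_distrib_left)
qed

lemma matching_sum_Un:
  assumes "finite A" "finite B" "A \<inter> B = {}" "\<And>f g. f \<in> A \<Longrightarrow> g \<in> B \<Longrightarrow> disjnt f g"
  shows "matching_sum (A \<union> B) z = matching_sum A z * matching_sum B z"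
  using assms
proof (induction A rule: finite_psubset_induct)
  case (psubset A)
  show ?case
  proof (cases "A = {}")
    case False
    then obtain e where e: "e \<in> A" by auto
    define A' where "A' = A - {e}"
    have A: "A = insert e A'" "e \<notin> A'" "finite A'"
      using e psubset.hyps by (auto simp: A'_def)
    have eB: "e \<notin> B" using e psubset.prems by auto
    have 1: "{f \<in> A' \<union> B. disjnt e f} = {f \<in> A'. disjnt e f} \<union> B"
      using e psubset.prems(3) by auto
    \<comment> \<open>The recursion at \<open>e\<close> calls for two smaller sets on the
      \<open>A\<close> side, hence the induction over proper subsets; \<open>B\<close> stays whole
      because \<open>e\<close> meets none of its edges.\<close>
    have 2: "matching_sum (A' \<union> B) z = matching_sum A' z * matching_sum B z"
      using A psubset.prems by (intro psubset.IH) auto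
    have 3: "matching_sum ({f \<in> A'. disjnt e f} \<union> B) z
        = matching_sum {f \<in> A'. disjnt e f} z * matching_sum B z"
      using A psubset.prems by (intro psubset.IH) auto
    have "matching_sum (A \<union> B) z = matching_sum (insert e (A' \<union> B)) z"
      by (simp add: A(1))
    also have "\<dots> = matching_sum (A' \<union> B) z + z * matching_sum {f \<in> A' \<union> B. disjnt e f} z"
      using A eB psubset.prems by (intro matching_sum_insert) auto
    also have "\<dots> = (matching_sum A' z + z * matching_sum {f \<in> A'. disjnt e f} z) * matching_sum B z"
      unfolding 1 2 3 by (simp add: algebra_simps)
    also have "\<dots> = matching_sum A z * matching_sum B z"
      using A by (simp add: matching_sum_insert)
    finally show ?thesis .
  qed simp
qed

lemma matching_sum_UN:
  assumes "finite I" "\<And>i. i \<in> I \<Longrightarrow> finite (C i)"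
    and "\<And>i j. i \<in> I \<Longrightarrow> j \<in> I \<Longrightarrow> i \<noteq> j \<Longrightarrow> C i \<inter> C j = {}"
    and "\<And>i j f g. i \<in> I \<Longrightarrow> j \<in> I \<Longrightarrow> i \<noteq> j \<Longrightarrow> f \<in> C i \<Longrightarrow> g \<in> C j \<Longrightarrow> disjnt f g"
  shows "matching_sum (\<Union>i\<in>I. C i) z = (\<Prod>i\<in>I. matching_sum (C i) z)"
  using assms
proof (induction I rule: finite_induct)
  case (insert i I)
  have "matching_sum (C i \<union> (\<Union>j\<in>I. C j)) z = matching_sum (C i) z * matching_sum (\<Union>j\<in>I. C j) z"
  proof (rule matching_sum_Un)
    show "C i \<inter> (\<Union>j\<in>I. C j) = {}"
      using insert.prems(2)[of i] insert.hyps(2) by fastforce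
    show "disjnt f g" if "f \<in> C i" "g \<in> (\<Union>j\<in>I. C j)" for f g
      using that insert.prems(3)[of i] insert.hyps(2) by auto
  qed (use insert in auto)
  moreover have "matching_sum (\<Union>j\<in>I. C j) z = (\<Prod>j\<in>I. matching_sum (C j) z)"
    by (rule insert.IH) (use insert.prems in \<open>simp, simp, meson insertI2\<close>)
  ultimately show ?case using insert.hyps by simp
qed simp

text \<open>At most one edge of a matching covers \<open>v\<close>; the matchings are sorted by that
  edge.\<close>

lemma matching_sum_vertex_expansion:
  assumes "finite E"
  shows "matching_sum E z = matching_sum {f \<in> E. v \<notin> f} z
           + z * (\<Sum>e | e \<in> E \<and> v \<in> e. matching_sum {f \<in> E. disjnt e f} z)"
proof -
  define B where "B = {f \<in> E. v \<notin> f}"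
  \<comment> \<open>The edges at \<open>v\<close> are added one by one. They pairwise meet in
    \<open>v\<close>, so the edges disjoint from a new one all lie in \<open>B\<close>.\<close>
  have expand: "matching_sum (A \<union> B) z
      = matching_sum B z + z * (\<Sum>e\<in>A. matching_sum {f \<in> B. disjnt e f} z)"
    if "finite A" "\<And>e. e \<in> A \<Longrightarrow> v \<in> e" for A
    using that
  proof (induction A rule: finite_induct)
    case (insert e A)
    have fin: "finite (A \<union> B)" using insert.hyps assms by (simp add: B_def)
    have notin: "e \<notin> A \<union> B" using insert by (auto simp: B_def)
    have "{f \<in> A \<union> B. disjnt e f} = {f \<in> B. disjnt e f}"
      using insert.prems unfolding disjnt_def by blast
    then show ?case
      using matching_sum_insert[OF fin notin, of z] insert by (simp add: algebra_simps)
  qed simp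
  have "E = {e \<in> E. v \<in> e} \<union> B" by (auto simp: B_def)
  then have "matching_sum E z = matching_sum ({e \<in> E. v \<in> e} \<union> B) z" by simp
  also have "\<dots> = matching_sum B z
      + z * (\<Sum>e | e \<in> E \<and> v \<in> e. matching_sum {f \<in> B. disjnt e f} z)"
    by (rule expand) (use assms in auto)
  also have "(\<Sum>e | e \<in> E \<and> v \<in> e. matching_sum {f \<in> B. disjnt e f} z)
      = (\<Sum>e | e \<in> E \<and> v \<in> e. matching_sum {f \<in> E. disjnt e f} z)"
    by (intro sum.cong refl arg_cong[where f = "\<lambda>E. matching_sum E z"]) (auto simp: B_def disjnt_def)
  finally show ?thesis by (simp add: B_def)
qed

text \<open>An injective renaming of vertices keeps edges distinct and preserves disjointness, so it
  carries matchings to matchings of the same size. This serves the two embeddings into a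
  coalescence.\<close>

lemma matching_sum_image:
  assumes "inj_on h (\<Union>E)"
  shows "matching_sum ((`) h ` E) z = matching_sum E z"
proof -
  have inj: "inj_on ((`) h) E"
    using inj_on_subset[OF inj_on_image_Pow[OF assms], of E] by blast
  have disj: "disjnt (h ` e) (h ` f) \<longleftrightarrow> disjnt e f" if "e \<in> E" "f \<in> E" for e f
    using that inj_on_image_Int[OF assms, of e f] unfolding disjnt_def
    by (metis Union_upper image_is_empty)
  have "bij_betw ((`) ((`) h)) {M. M \<subseteq> E \<and> pairwise disjnt M}
      {M. M \<subseteq> (`) h ` E \<and> pairwise disjnt M}"
  proof (rule bij_betw_imageI)
    show "inj_on ((`) ((`) h)) {M. M \<subseteq> E \<and> pairwise disjnt M}"
      by (rule inj_on_subset[OF inj_on_image_Pow[OF inj]]) auto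
    have *: "pairwise disjnt ((`) h ` M) \<longleftrightarrow> pairwise disjnt M" if "M \<subseteq> E" for M
    proof -
      have "h ` e = h ` f \<longleftrightarrow> e = f" "disjnt (h ` e) (h ` f) \<longleftrightarrow> disjnt e f"
        if "e \<in> M" "f \<in> M" for e f
        using that \<open>M \<subseteq> E\<close> disj[of e f] inj_on_eq_iff[OF inj, of e f] by auto
      then show ?thesis unfolding pairwise_def by simp
    qed
    show "(`) ((`) h) ` {M. M \<subseteq> E \<and> pairwise disjnt M}
        = {M. M \<subseteq> (`) h ` E \<and> pairwise disjnt M}"
    proof (intro equalityI subsetI)
      fix N assume "N \<in> {M. M \<subseteq> (`) h ` E \<and> pairwise disjnt M}"
      moreover from this obtain M where "M \<subseteq> E" "N = (`) h ` M"
        by (auto elim: subset_imageE)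
      ultimately show "N \<in> (`) ((`) h) ` {M. M \<subseteq> E \<and> pairwise disjnt M}"
        using * by auto
    next
      fix N assume "N \<in> (`) ((`) h) ` {M. M \<subseteq> E \<and> pairwise disjnt M}"
      then show "N \<in> {M. M \<subseteq> (`) h ` E \<and> pairwise disjnt M}"
        using * by (elim imageE) (simp add: image_mono)
    qed
  qed
  then have "matching_sum ((`) h ` E) z
      = (\<Sum>M | M \<subseteq> E \<and> pairwise disjnt M. z ^ card ((`) h ` M))"
    unfolding matching_sum_def by (rule sum.reindex_bij_betw[symmetric])
  also have "\<dots> = matching_sum E z"
    unfolding matching_sum_def
  proof (rule sum.cong)
    fix M assume "M \<in> {M. M \<subseteq> E \<and> pairwise disjnt M}"
    then have "card ((`) h ` M) = card M"
      by (intro card_image inj_on_subset[OF inj]) blast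
    then show "z ^ card ((`) h ` M) = z ^ card M" by (rule arg_cong)
  qed (rule refl)
  finally show ?thesis .
qed

text \<open>Inclusion-exclusion: a matching of the union is a pair of matchings of which at most one
  covers \<open>c\<close>. The first two products count the pairs avoiding \<open>c\<close> on one
  given side, the third those counted twice. The proof compares the expansions at \<open>c\<close>
  of all three sums.\<close>

lemma matching_sum_cut_vertex:
  assumes fin: "finite A" "finite B" and disj: "A \<inter> B = {}"
    and cut: "\<And>f g. f \<in> A \<Longrightarrow> g \<in> B \<Longrightarrow> f \<inter> g \<subseteq> {c}"
  defines "A' \<equiv> {f \<in> A. c \<notin> f}" and "B' \<equiv> {f \<in> B. c \<notin> f}"
  shows "matching_sum (A \<union> B) z = matching_sum A z * matching_sum B' z
           + matching_sum A' z * matching_sum B z - matching_sum A' z * matching_sum B' z"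
proof -
  let ?S = "\<lambda>E. matching_sum E z"
  let ?N = "\<lambda>E e. {f \<in> E. disjnt e f}"
  have prod: "?S (X \<union> Y) = ?S X * ?S Y"
    if "X \<subseteq> A" "Y \<subseteq> B" "\<And>f g. f \<in> X \<Longrightarrow> g \<in> Y \<Longrightarrow> c \<notin> f \<or> c \<notin> g" for X Y
  proof (rule matching_sum_Un)
    show "disjnt f g" if "f \<in> X" "g \<in> Y" for f g
      using that cut[of f g] \<open>X \<subseteq> A\<close> \<open>Y \<subseteq> B\<close> \<open>\<And>f g. f \<in> X \<Longrightarrow> g \<in> Y \<Longrightarrow> c \<notin> f \<or> c \<notin> g\<close>[of f g]
      unfolding disjnt_def by blast
  qed (use that fin disj in \<open>auto intro: finite_subset\<close>)
  \<comment> \<open>An edge of \<open>A\<close> through \<open>c\<close> meets precisely those edges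
    of \<open>B\<close> that contain \<open>c\<close>.\<close>
  have NA: "?N (A \<union> B) e = ?N A e \<union> B'" if "e \<in> A" "c \<in> e" for e
    using that cut[OF that(1)] unfolding B'_def disjnt_def by blast
  have NB: "?N (A \<union> B) e = A' \<union> ?N B e" if "e \<in> B" "c \<in> e" for e
    using that cut[OF _ that(1)] unfolding A'_def disjnt_def by blast
  have SA: "?S (?N A e \<union> B') = ?S (?N A e) * ?S B'" for e by (rule prod) (auto simp: B'_def)
  have SB: "?S (A' \<union> ?N B e) = ?S A' * ?S (?N B e)" for e by (rule prod) (auto simp: A'_def)
  have "{f \<in> A \<union> B. c \<notin> f} = A' \<union> B'" by (auto simp: A'_def B'_def)
  then have "?S (A \<union> B) = ?S (A' \<union> B') + z * (\<Sum>e | e \<in> A \<union> B \<and> c \<in> e. ?S (?N (A \<union> B) e))"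
    using matching_sum_vertex_expansion[of "A \<union> B" z c] fin by simp
  also have "?S (A' \<union> B') = ?S A' * ?S B'" by (rule prod) (auto simp: A'_def B'_def)
  also have "(\<Sum>e | e \<in> A \<union> B \<and> c \<in> e. ?S (?N (A \<union> B) e))
      = (\<Sum>e\<in>{e \<in> A. c \<in> e} \<union> {e \<in> B. c \<in> e}. ?S (?N (A \<union> B) e))"
    by (rule sum.cong) auto
  also have "\<dots> = (\<Sum>e | e \<in> A \<and> c \<in> e. ?S (?N (A \<union> B) e)) + (\<Sum>e | e \<in> B \<and> c \<in> e. ?S (?N (A \<union> B) e))"
    using fin disj by (subst sum.union_disjoint) auto
  also have "\<dots> = (\<Sum>e | e \<in> A \<and> c \<in> e. ?S (?N A e)) * ?S B' + ?S A' * (\<Sum>e | e \<in> B \<and> c \<in> e. ?S (?N B e))"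
    unfolding sum_distrib_left sum_distrib_right
    by (intro arg_cong2[where f = "(+)"] sum.cong) (use NA NB SA SB in auto)
  finally have main: "?S (A \<union> B) = ?S A' * ?S B' + z * ((\<Sum>e | e \<in> A \<and> c \<in> e. ?S (?N A e)) * ?S B'
      + ?S A' * (\<Sum>e | e \<in> B \<and> c \<in> e. ?S (?N B e)))" .
  have "?S A = ?S A' + z * (\<Sum>e | e \<in> A \<and> c \<in> e. ?S (?N A e))"
    using matching_sum_vertex_expansion[OF fin(1), of z c] by (simp add: A'_def)
  moreover have "?S B = ?S B' + z * (\<Sum>e | e \<in> B \<and> c \<in> e. ?S (?N B e))"
    using matching_sum_vertex_expansion[OF fin(2), of z c] by (simp add: B'_def)
  ultimately show ?thesis unfolding main by (simp add: algebra_simps)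
qed

section \<open>The least positive zero\<close>

lemma coeff_matching_sum:
  assumes "finite (edges H)"
  shows "coeff (matching_sum (edges H) (monom (1::real) 1)) k = of_nat (matchings_num H k)"
proof -
  let ?\<M> = "{M. M \<subseteq> edges H \<and> pairwise disjnt M}"
  have "coeff (matching_sum (edges H) (monom (1::real) 1)) k = (\<Sum>M\<in>?\<M>. if card M = k then 1 else 0)"
    by (simp add: matching_sum_def coeff_sum monom_power)
  also have "\<dots> = of_nat (card {M \<in> ?\<M>. card M = k})"
    using assms by (subst sum.If_cases) (auto intro: arg_cong[where f = card])
  also have "{M \<in> ?\<M>. card M = k} = {M. M \<subseteq> edges H \<and> card M = k \<and>
      (\<forall>e\<in>M. \<forall>f\<in>M. e \<noteq> f \<longrightarrow> e \<inter> f = {})}"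
    by (auto simp: pairwise_def disjnt_def)
  finally show ?thesis by (simp add: matchings_num_def)
qed

lemma poly_matching_sum: "poly (matching_sum E p) x = matching_sum E (poly p x)"
  by (simp add: matching_sum_def poly_sum)

lemma finite_edges: "uniform_hg r H \<Longrightarrow> finite (edges H)"
  by (rule finite_subset[of _ "Pow (verts H)"]) (auto simp: uniform_hg_def)

lemma matching_sum_eqI:
  assumes "uniform_hg r G" "uniform_hg r H" "\<And>k. matchings_num G k = matchings_num H k"
  shows "matching_sum (edges G) (monom (1::real) 1) = matching_sum (edges H) (monom 1 1)"
  using assms by (intro poly_eqI) (simp add: coeff_matching_sum finite_edges del: One_nat_def)

text \<open>Disjoint edges of a \<open>k\<close>-matching cover \<open>k * r\<close> vertices. This
  settles the matching numbers beyond the summation range of \<open>matching_poly\<close>.\<close>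

lemma matchings_num_eq_0:
  assumes H: "uniform_hg r H" and "r > 0" and k: "k > card (verts H) div r"
  shows "matchings_num H k = 0"
proof -
  have False if M: "M \<subseteq> edges H" "card M = k" "\<forall>e\<in>M. \<forall>f\<in>M. e \<noteq> f \<longrightarrow> e \<inter> f = {}" for M
  proof -
    have e: "e \<subseteq> verts H" "card e = r" "finite e" if "e \<in> M" for e
      using that M(1) H by (auto simp: uniform_hg_def intro: finite_subset)
    have "card (\<Union>M) = (\<Sum>e\<in>M. card e)"
      using M(3) e by (intro card_Union_disjoint) (auto simp: pairwise_def disjnt_def)
    also have "\<dots> = k * r" using e M(2) by simp
    finally have "k * r \<le> card (verts H)"
      using e H by (metis Union_least card_mono uniform_hg_def)
    then show False
      using k \<open>r > 0\<close> by (simp add: div_less_iff_less_mult flip: not_less)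
  qed
  then have "{M. M \<subseteq> edges H \<and> card M = k \<and> (\<forall>e\<in>M. \<forall>f\<in>M. e \<noteq> f \<longrightarrow> e \<inter> f = {})} = {}"
    by blast
  then show ?thesis unfolding matchings_num_def by (metis card.empty)
qed

lemma coeff_matching_poly:
  assumes "r > 0" "k \<le> card (verts H) div r"
  shows "coeff (matching_poly r H) (card (verts H) - k * r) = (-1) ^ k * of_nat (matchings_num H k)"
proof -
  let ?n = "card (verts H)"
  \<comment> \<open>Within the summation range the natural subtraction is not truncated, so
    different \<open>j\<close> give different exponents and each coefficient comes from a single
    summand.\<close>
  have le: "j * r \<le> ?n" if "j \<le> ?n div r" for j
    using that \<open>r > 0\<close> by (simp add: less_eq_div_iff_mult_less_eq)
  have "?n - j * r = ?n - k * r \<longleftrightarrow> j = k" if "j \<le> ?n div r" for j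
  proof -
    have "?n - j * r = ?n - k * r \<longleftrightarrow> j * r = k * r"
      using le[OF that] le[OF assms(2)] by arith
    then show ?thesis using \<open>r > 0\<close> by simp
  qed
  then have "coeff (matching_poly r H) (?n - k * r)
      = (\<Sum>j = 0..?n div r. if j = k then (-1) ^ j * of_nat (matchings_num H j) else 0)"
    unfolding matching_poly_def coeff_sum coeff_monom by (intro sum.cong) auto
  then show ?thesis using assms(2) by simp
qed

text \<open>Both directions serve: the hypotheses on the parts become statements about matching
  numbers, and the result for the coalescences is turned back into polynomials.\<close>

lemma matching_poly_eq_iff:
  assumes "uniform_hg r G" "uniform_hg r H" "r > 0" "card (verts G) = card (verts H)"
  shows "matching_poly r G = matching_poly r H \<longleftrightarrow> (\<forall>k. matchings_num G k = matchings_num H k)"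
proof
  assume eq: "matching_poly r G = matching_poly r H"
  show "\<forall>k. matchings_num G k = matchings_num H k"
  proof
    fix k
    show "matchings_num G k = matchings_num H k"
    proof (cases "k \<le> card (verts G) div r")
      case True
      then show ?thesis
        using coeff_matching_poly[of r k G] coeff_matching_poly[of r k H] eq assms by simp
    next
      case False
      then show ?thesis
        using matchings_num_eq_0[of r G k] matchings_num_eq_0[of r H k] assms by simp
    qed
  qed
next
  assume "\<forall>k. matchings_num G k = matchings_num H k"
  then show "matching_poly r G = matching_poly r H"
    using assms(4) by (simp add: matching_poly_def)
qed

section \<open>Zeros of matching sums\<close>

lemma least_zero:
  fixes f :: "real \<Rightarrow> real"
  assumes cont: "continuous_on UNIV f" and "f 0 > 0" "b \<ge> 0" "f b \<le> 0"
  obtains c where "0 < c" "c \<le> b" "f c = 0" "\<And>x. 0 \<le> x \<Longrightarrow> x < c \<Longrightarrow> f x > 0"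
proof -
  \<comment> \<open>Minimising over the points with \<open>f x \<le> 0\<close> instead of the zeros
    gives positivity to the left of the minimum at once.\<close>
  let ?Z = "{x \<in> {0..b}. f x \<le> 0}"
  have "closed {x. f x \<le> 0}" by (intro closed_Collect_le cont continuous_on_const)
  then have "compact ({0..b} \<inter> {x. f x \<le> 0})" by (intro compact_Int_closed compact_Icc)
  moreover have "{0..b} \<inter> {x. f x \<le> 0} = ?Z" by auto
  ultimately have "compact ?Z" by simp
  moreover have "?Z \<noteq> {}" using assms by auto
  ultimately obtain c where c: "c \<in> ?Z" and min: "\<forall>x\<in>?Z. c \<le> x"
    using compact_attains_inf by blast
  have pos: "f x > 0" if "0 \<le> x" "x < c" for x
    using that bspec[OF min, of x] c by fastforce
  have "c > 0" using c \<open>f 0 > 0\<close> by (cases "c = 0") auto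
  \<comment> \<open>A negative value at \<open>c\<close> would force an earlier zero by the
    intermediate value theorem.\<close>
  have "f c \<ge> 0"
  proof (rule ccontr)
    assume "\<not> f c \<ge> 0"
    then obtain x where "0 \<le> x" "x \<le> c" "f x = 0"
      using IVT2'[of f c 0 0] \<open>f 0 > 0\<close> \<open>c > 0\<close> cont by (auto intro: continuous_on_subset)
    then show False using pos[of x] \<open>\<not> f c \<ge> 0\<close> by (cases "x = c") auto
  qed
  then have "f c = 0" using c by auto
  then show ?thesis using that[of c] c pos \<open>c > 0\<close> by auto
qed

lemma continuous_on_matching_sum:
  "continuous_on X (\<lambda>b::real. matching_sum E (- b))"
  unfolding matching_sum_def by (intro continuous_intros)

lemma matching_sum_0 [simp]: "finite E \<Longrightarrow> matching_sum E (0::real) = 1"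
proof (induction E rule: finite_induct)
  case (insert e E)
  then show ?case by (simp add: matching_sum_insert)
qed simp

lemma matching_sum_remove:
  assumes "finite E" "e \<in> E"
  shows "matching_sum E z = matching_sum (E - {e}) z + z * matching_sum {f \<in> E - {e}. disjnt e f} z"
  using matching_sum_insert[of "E - {e}" e z] assms by (simp add: insert_absorb)

lemma nonneg_at_right_end:
  fixes f :: "real \<Rightarrow> real"
  assumes "continuous_on UNIV f" "c > 0" "\<And>x. 0 \<le> x \<Longrightarrow> x < c \<Longrightarrow> f x > 0"
  shows "f c \<ge> 0"
proof (rule tendsto_lowerbound)
  show "(f \<longlongrightarrow> f c) (at_left c)"
    using assms(1) by (auto simp: continuous_on_def intro: tendsto_within_subset)
  show "\<forall>\<^sub>F x in at_left c. 0 \<le> f x"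
    using assms(2,3) by (intro eventually_at_leftI[of 0]) (auto intro: less_imp_le)
qed simp

text \<open>The matching polynomial is the independence polynomial of the intersection graph of the
  edges; deleting edges can only move its least positive zero to the right.\<close>

lemma matching_sum_pos_mono:
  assumes "finite E" "F \<subseteq> E" "0 \<le> b" "b < a"
    and "\<And>b::real. 0 \<le> b \<Longrightarrow> b < a \<Longrightarrow> matching_sum E (- b) > 0"
  shows "matching_sum F (- b) > 0"
  using assms
proof (induction E arbitrary: F a b rule: finite_psubset_induct)
  case (psubset E)
  show ?case
  proof (cases "F = E")
    case False
    then obtain e where e: "e \<in> E" "F \<subseteq> E - {e}"
      using psubset.prems(1) by auto
    have fin: "finite (E - {e})" and sub: "E - {e} \<subset> E" using psubset.hyps e by auto
    \<comment> \<open>Otherwise let \<open>c < a\<close> be the least zero for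
      \<open>E - {e}\<close>. By induction the sum over the edges disjoint from \<open>e\<close> is
      positive before \<open>c\<close>, hence nonnegative at \<open>c\<close>, and the recursion
      makes the sum over \<open>E\<close> nonpositive there.\<close>
    have "matching_sum (E - {e}) (- b) > 0" if "0 \<le> b" "b < a" for b
    proof (rule ccontr)
      assume "\<not> matching_sum (E - {e}) (- b) > 0"
      then obtain c where c: "0 < c" "c \<le> b" "matching_sum (E - {e}) (- c) = 0"
          "\<And>x. 0 \<le> x \<Longrightarrow> x < c \<Longrightarrow> matching_sum (E - {e}) (- x) > 0"
        using least_zero[OF continuous_on_matching_sum, of "E - {e}" b] fin \<open>0 \<le> b\<close> by auto
      have "matching_sum {f \<in> E - {e}. disjnt e f} (- x) > 0" if "0 \<le> x" "x < c" for x
        by (rule psubset.IH[OF sub _ that c(4)]) auto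
      then have "matching_sum {f \<in> E - {e}. disjnt e f} (- c) \<ge> 0"
        using c(1) by (intro nonneg_at_right_end[OF continuous_on_matching_sum]) auto
      then have "matching_sum E (- c) \<le> 0"
        using matching_sum_remove[OF psubset.hyps e(1), of "- c"] c(1,3) by simp
      then show False using psubset.prems(4)[of c] c(1,2) \<open>b < a\<close> by auto
    qed
    then show ?thesis using psubset.IH[OF sub e(2) psubset.prems(2,3)] by blast
  qed (use psubset.prems in auto)
qed

lemma matching_sum_nonneg_mono:
  assumes "finite E" "F \<subseteq> E" "0 < a" "\<And>b::real. 0 \<le> b \<Longrightarrow> b < a \<Longrightarrow> matching_sum E (- b) > 0"
  shows "matching_sum F (- a) \<ge> 0"
  using matching_sum_pos_mono[OF assms(1,2) _ _ assms(4)] assms(3)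
  by (intro nonneg_at_right_end[OF continuous_on_matching_sum]) auto

lemma matching_sum_least_zero:
  assumes "finite E" "E \<noteq> {}"
  obtains a :: real where "0 < a" "matching_sum E (- a) = 0"
    "\<And>b. 0 \<le> b \<Longrightarrow> b < a \<Longrightarrow> matching_sum E (- b) > 0"
proof -
  obtain e where e: "e \<in> E" using assms by auto
  have "\<exists>b\<ge>0. matching_sum E (- b :: real) \<le> 0"
  proof (rule ccontr)
    assume "\<not> (\<exists>b\<ge>0. matching_sum E (- b :: real) \<le> 0)"
    then have "matching_sum E (- b) > 0" if "b \<ge> 0" for b :: real
      using that by (meson not_le)
    \<comment> \<open>Without a zero, positivity would pass to the single edge \<open>e\<close>,
      whose sum at \<open>- 1\<close> is \<open>1 - 1 = 0\<close>. Any bound above \<open>1\<close>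
      would do for the \<open>2\<close>.\<close>
    then have "matching_sum {e} (- 1 :: real) > 0"
      using e matching_sum_pos_mono[OF assms(1), of "{e}" 1 2] by auto
    then show False using matching_sum_insert[of "{}" e "- 1 :: real"] by simp
  qed
  then obtain b where "b \<ge> 0" "matching_sum E (- b :: real) \<le> 0" by auto
  then show ?thesis
    using least_zero[OF continuous_on_matching_sum, of E b] assms that by auto
qed

text \<open>Monotonicity only gives nonnegativity at \<open>a\<close>. Strictness comes from an edge
  \<open>e\<close> outside \<open>F\<close> that meets \<open>F\<close>: the sum over
  \<open>F\<close> exceeds the nonnegative sum over \<open>insert e F\<close> by \<open>a\<close>
  times the sum over the edges of \<open>F\<close> disjoint from \<open>e\<close>. These form a
  proper subset of \<open>F\<close>, so induction applies.\<close>

lemma matching_sum_pos_at_least_zero: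
  assumes fin: "finite E" and a: "0 < (a::real)"
    and pos: "\<And>b. 0 \<le> b \<Longrightarrow> b < a \<Longrightarrow> matching_sum E (- b) > 0"
    and conn: "\<And>F. F \<subset> E \<Longrightarrow> F \<noteq> {} \<Longrightarrow> \<exists>e\<in>E - F. \<exists>f\<in>F. \<not> disjnt e f"
    and F: "F \<subset> E"
  shows "matching_sum F (- a) > 0"
  using finite_subset[OF psubset_imp_subset[OF F] fin] F
proof (induction F rule: finite_psubset_induct)
  case (psubset F)
  show ?case
  proof (cases "F = {}")
    case False
    then obtain e f where ef: "e \<in> E - F" "f \<in> F" "\<not> disjnt e f"
      using conn psubset.prems by blast
    have "matching_sum {f \<in> F. disjnt e f} (- a) > 0"
      using ef psubset.prems by (intro psubset.IH) auto
    then have "matching_sum F (- a) > matching_sum (insert e F) (- a)"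
      using a ef psubset.hyps by (simp add: matching_sum_insert)
    moreover have "matching_sum (insert e F) (- a) \<ge> 0"
      using ef psubset.prems by (intro matching_sum_nonneg_mono[OF fin _ a pos]) auto
    ultimately show ?thesis by simp
  qed simp
qed

section \<open>Branches of a tree at an edge\<close>

text \<open>A version of \<open>hg_adj\<close> on bare edge sets, so that edges can be removed
  without building a hypergraph.\<close>

definition edge_adj :: "'a set set \<Rightarrow> ('a \<times> 'a) set" where
  "edge_adj E = {(x, y). \<exists>e\<in>E. x \<in> e \<and> y \<in> e}"

text \<open>This form of acyclicity is easier to transport along a coalescence than the absence of
  Berge cycles.\<close>

definition acyclic_edges :: "'a set set \<Rightarrow> bool" where
  "acyclic_edges E \<longleftrightarrow> (\<forall>e\<in>E. \<forall>u\<in>e. \<forall>w\<in>e. (u, w) \<in> (edge_adj (E - {e}))\<^sup>* \<longrightarrow> u = w)"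

lemma hg_adj_conv_edge_adj: "hg_adj H = edge_adj (edges H)"
  by (simp add: hg_adj_def edge_adj_def)

lemma sym_edge_adj_rtrancl: "(x, y) \<in> (edge_adj E)\<^sup>* \<Longrightarrow> (y, x) \<in> (edge_adj E)\<^sup>*"
  by (rule symD[OF sym_rtrancl]) (auto simp: sym_def edge_adj_def)

text \<open>A shortest path that joins two vertices of \<open>e\<close> without using
  \<open>e\<close> closes up with \<open>e\<close> to a Berge cycle; minimality yields distinct
  vertices and distinct edges.\<close>

lemma acyclic_edges_if_no_berge_cycle:
  assumes "\<not> has_berge_cycle H"
  shows "acyclic_edges (edges H)"
proof (rule ccontr)
  assume "\<not> acyclic_edges (edges H)"
  then obtain e u w where e: "e \<in> edges H" "u \<in> e" "w \<in> e" "u \<noteq> w"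
      and path: "(u, w) \<in> (edge_adj (edges H - {e}))\<^sup>*"
    by (auto simp: acyclic_edges_def)
  define R where "R = edge_adj (edges H - {e})"
  define n where "n = (LEAST n. (u, w) \<in> R ^^ n)"
  have "\<exists>n. (u, w) \<in> R ^^ n" using path by (simp add: R_def flip: rtrancl_power)
  then have uw: "(u, w) \<in> R ^^ n" unfolding n_def by (rule LeastI_ex)
  have minimal: "(u, w) \<notin> R ^^ m" if "m < n" for m
    using that not_less_Least unfolding n_def by blast
  obtain p where p: "p 0 = u" "p n = w" "\<And>i. i < n \<Longrightarrow> (p i, p (Suc i)) \<in> R"
    using uw by (auto simp: relpow_fun_conv)
  have "\<forall>i\<in>{..<n}. \<exists>f\<in>edges H - {e}. p i \<in> f \<and> p (Suc i) \<in> f"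
    using p(3) by (auto simp: R_def edge_adj_def)
  then obtain h where h: "\<And>i. i < n \<Longrightarrow> h i \<in> edges H - {e} \<and> p i \<in> h i \<and> p (Suc i) \<in> h i"
    by (metis lessThan_iff)
  have segment: "(p i, p j) \<in> R ^^ (j - i)" if "i \<le> j" "j \<le> n" for i j
    unfolding relpow_fun_conv using that p(3) by (intro exI[of _ "\<lambda>k. p (i + k)"]) auto
  have no_shortcut: "(p i, p j) \<notin> R ^^ d" if "i < j" "j \<le> n" "d < j - i" for i j d
  proof
    assume "(p i, p j) \<in> R ^^ d"
    moreover have "(u, p i) \<in> R ^^ i" "(p j, w) \<in> R ^^ (n - j)"
      using segment[of 0 i] segment[of j n] that p(1,2) by auto
    ultimately have "(u, w) \<in> R ^^ (i + (d + (n - j)))"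
      unfolding relpow_add by blast
    moreover have "i + (d + (n - j)) < n" using that by linarith
    ultimately show False using minimal by blast
  qed
  have p_neq: "p i \<noteq> p j" if "i < j" "j \<le> n" for i j
    using no_shortcut[of i j 0] that by auto
  \<comment> \<open>A repeated edge contains both \<open>p i\<close> and \<open>p (Suc j)\<close>,
    so one step would replace at least two.\<close>
  have h_neq: "h i \<noteq> h j" if "i < j" "j < n" for i j
  proof
    assume "h i = h j"
    then have "(p i, p (Suc j)) \<in> R ^^ 1"
      using h[of i] h[of j] that by (auto simp: R_def edge_adj_def)
    moreover have "i < Suc j" "Suc j \<le> n" "1 < Suc j - i" using that by linarith+
    ultimately show False using no_shortcut by blast
  qed
  have "n > 0" using e(4) p(1,2) by (cases n) auto
  \<comment> \<open>The closing edge \<open>e\<close> joins the last vertex \<open>w\<close> to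
    \<open>u\<close>, which is where the index wraps around.\<close>
  let ?vs = "map p [0..<Suc n]" and ?es = "map h [0..<n] @ [e]"
  have "distinct ?vs"
    unfolding distinct_map
    by (auto simp: less_Suc_eq_le simp del: upt_Suc intro!: linorder_inj_onI dest: p_neq)
  moreover have "distinct ?es"
  proof -
    have "h i \<noteq> e" if "i < n" for i using h[OF that] by blast
    then have "e \<notin> h ` {0..<n}" by force
    then show ?thesis
      unfolding distinct_append distinct_map by (auto intro!: linorder_inj_onI dest: h_neq)
  qed
  moreover have "set ?es \<subseteq> edges H" using h e(1) by auto
  moreover have "?vs ! i \<in> ?es ! i \<and> ?vs ! ((i + 1) mod length ?vs) \<in> ?es ! i" if "i < length ?vs" for i
  proof (cases "i = n")
    case True
    then show ?thesis using e p(1,2) by (simp add: nth_append del: upt_Suc)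
  next
    case False
    then have "i < n" using that by simp
    then show ?thesis using h[of i] by (simp add: nth_append del: upt_Suc)
  qed
  moreover have "length ?vs \<ge> 2" "length ?es = length ?vs" using \<open>n > 0\<close> by auto
  ultimately have "has_berge_cycle H" unfolding has_berge_cycle_def by blast
  then show False using assms by contradiction
qed

text \<open>After exchanging the products, each \<open>w\<close> occurs once for every
  \<open>u\<close> other than itself.\<close>

lemma prod_prod_remove:
  fixes c :: "'a \<Rightarrow> 'b::comm_ring_1"
  assumes "finite A"
  shows "(\<Prod>u\<in>A. \<Prod>w\<in>A - {u}. c w) = (\<Prod>w\<in>A. c w) ^ (card A - 1)"
proof -
  have "(\<Prod>u\<in>A. \<Prod>w\<in>A - {u}. c w) = (\<Prod>u\<in>A. \<Prod>w | w \<in> A \<and> u \<noteq> w. c w)"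
    by (intro prod.cong) auto
  also have "\<dots> = (\<Prod>w\<in>A. \<Prod>u | u \<in> A \<and> u \<noteq> w. c w)"
    by (rule prod.swap_restrict) (use assms in auto)
  also have "\<dots> = (\<Prod>w\<in>A. c w ^ (card A - 1))"
  proof (rule prod.cong)
    fix w assume "w \<in> A"
    then have "card {u \<in> A. u \<noteq> w} = card A - 1"
      using card_Diff_singleton[of w A] by (simp add: set_diff_eq)
    then show "(\<Prod>u | u \<in> A \<and> u \<noteq> w. c w) = c w ^ (card A - 1)" by simp
  qed simp
  finally show ?thesis by (simp add: prod_power_distrib)
qed

text \<open>Removing \<open>e\<close> splits a tree into one branch \<open>C u\<close> for each vertex \<open>u\<close> of \<open>e\<close>, and all
  matching sums involved factor over the branches.\<close>

lemma prod_matching_sum_delete_vertex: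
  fixes z :: "'b::comm_ring_1"
  assumes fin: "finite E" and acyc: "acyclic_edges E"
    and conn: "\<And>x y. x \<in> \<Union>E \<Longrightarrow> y \<in> \<Union>E \<Longrightarrow> (x, y) \<in> (edge_adj E)\<^sup>*"
    and nonempty: "{} \<notin> E" and e: "e \<in> E" "finite e"
    and zero: "matching_sum E z = 0"
  shows "(\<Prod>u\<in>e. matching_sum {f \<in> E. u \<notin> f} z)
    = (- z) ^ (card e - 1) * matching_sum {f \<in> E. disjnt e f} z ^ card e"
proof -
  let ?R = "(edge_adj (E - {e}))\<^sup>*"
  let ?S = "\<lambda>E. matching_sum E z"
  \<comment> \<open>\<open>C u\<close> is the branch hanging off \<open>e\<close> at
    \<open>u\<close>. Acyclicity makes different branches vertex-disjoint and lets a branch meet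
    \<open>e\<close> at most in its own root; connectedness makes them exhaust
    \<open>E - {e}\<close>.\<close>
  define C where "C u = {f \<in> E - {e}. \<exists>x\<in>f. (u, x) \<in> ?R}" for u
  define C' where "C' u = {f \<in> C u. u \<notin> f}" for u
  have sep: "u = w" if "u \<in> e" "w \<in> e" "(u, w) \<in> ?R" for u w
    using acyc e(1) that by (auto simp: acyclic_edges_def)
  have reach: "(u, x) \<in> ?R" if "f \<in> C u" "x \<in> f" for u f x
  proof -
    from that(1) obtain y where y: "f \<in> E - {e}" "y \<in> f" "(u, y) \<in> ?R" by (auto simp: C_def)
    then have "(y, x) \<in> edge_adj (E - {e})" using that(2) by (auto simp: edge_adj_def)
    with y(3) show ?thesis by (rule rtrancl_into_rtrancl)
  qed
  have branch_disj: "disjnt f g" if "u \<in> e" "w \<in> e" "u \<noteq> w" "f \<in> C u" "g \<in> C w" for u w f g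
  proof (rule ccontr)
    assume "\<not> disjnt f g"
    then obtain x where "x \<in> f" "x \<in> g" by (auto simp: disjnt_iff)
    then have "(u, x) \<in> ?R" "(x, w) \<in> ?R"
      using reach that by (auto intro: sym_edge_adj_rtrancl)
    then show False using sep[of u w] that by (auto intro: rtrancl_trans)
  qed
  have branch_e: "w = u" if "u \<in> e" "w \<in> e" "f \<in> C u" "w \<in> f" for u w f
    using sep reach that by metis
  have C_Int: "C u \<inter> C w = {}" if "u \<in> e" "w \<in> e" "u \<noteq> w" for u w
  proof (rule equals0I)
    fix f assume "f \<in> C u \<inter> C w"
    then have "f \<in> C u" "f \<in> C w" by auto
    then have "disjnt f f" using branch_disj[OF that] by blast
    moreover have "f \<in> E" using \<open>f \<in> C u\<close> by (simp add: C_def)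
    ultimately show False using nonempty by (auto simp: disjnt_def)
  qed
  have cover: "\<exists>u\<in>e. (u, x) \<in> ?R" if "(a, x) \<in> (edge_adj E)\<^sup>*" "a \<in> e" for a x
    using that(1)
  proof (induction rule: rtrancl_induct)
    case (step y x)
    from step.hyps(2) obtain f where f: "f \<in> E" "y \<in> f" "x \<in> f" by (auto simp: edge_adj_def)
    show ?case
    proof (cases "f = e")
      case False
      then have "(y, x) \<in> edge_adj (E - {e})" using f by (auto simp: edge_adj_def)
      then show ?thesis using step.IH by (meson rtrancl.rtrancl_into_rtrancl)
    qed (use f in auto)
  qed (use that(2) in auto)
  obtain a where a: "a \<in> e" using nonempty e(1) by (metis all_not_in_conv)
  have branches: "E - {e} = (\<Union>u\<in>e. C u)"
  proof (intro equalityI subsetI)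
    fix f assume f: "f \<in> E - {e}"
    then obtain x where x: "x \<in> f" using nonempty by (metis DiffD1 all_not_in_conv)
    then have "(a, x) \<in> (edge_adj E)\<^sup>*" using conn a e(1) f by blast
    then show "f \<in> (\<Union>u\<in>e. C u)" using cover a f x by (auto simp: C_def)
  qed (auto simp: C_def)
  have finC: "finite (C u)" for u using fin by (auto simp: C_def)
  have SC: "?S (\<Union>u\<in>e. C u) = (\<Prod>u\<in>e. ?S (C u))"
    by (rule matching_sum_UN) (use e finC C_Int branch_disj in auto)
  have SC': "?S (\<Union>u\<in>e. C' u) = (\<Prod>u\<in>e. ?S (C' u))"
    by (rule matching_sum_UN) (use e finC C_Int branch_disj in \<open>auto simp: C'_def\<close>)
  \<comment> \<open>A branch edge can meet \<open>e\<close> only in the root of its branch, so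
    avoiding that root means avoiding \<open>e\<close>.\<close>
  have delete_edge: "{f \<in> E. disjnt e f} = (\<Union>u\<in>e. C' u)"
  proof (intro equalityI subsetI)
    fix f assume f: "f \<in> {f \<in> E. disjnt e f}"
    then have "f \<noteq> e" using nonempty by (auto simp: disjnt_def)
    then obtain u where "u \<in> e" "f \<in> C u" using f branches by blast
    then show "f \<in> (\<Union>u\<in>e. C' u)" using f by (auto simp: C'_def disjnt_iff)
  next
    fix f assume "f \<in> (\<Union>u\<in>e. C' u)"
    then obtain u where u: "u \<in> e" "f \<in> C u" "u \<notin> f" by (auto simp: C'_def)
    then have "disjnt e f" using branch_e by (metis disjnt_iff)
    then show "f \<in> {f \<in> E. disjnt e f}" using u by (auto simp: C_def)
  qed
  \<comment> \<open>Deleting \<open>u\<close> destroys \<open>e\<close> and thins out the branch at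
    \<open>u\<close>, but leaves the other branches intact.\<close>
  have delete_vertex: "?S {f \<in> E. u \<notin> f} = ?S (C' u) * (\<Prod>w\<in>e - {u}. ?S (C w))" if u: "u \<in> e" for u
  proof -
    have "{f \<in> E. u \<notin> f} = C' u \<union> (\<Union>w\<in>e - {u}. C w)"
    proof (intro equalityI subsetI)
      fix f assume f: "f \<in> {f \<in> E. u \<notin> f}"
      then have "f \<in> E - {e}" using u by auto
      then show "f \<in> C' u \<union> (\<Union>w\<in>e - {u}. C w)" using f branches by (auto simp: C'_def)
    next
      fix f assume "f \<in> C' u \<union> (\<Union>w\<in>e - {u}. C w)"
      then show "f \<in> {f \<in> E. u \<notin> f}"
        using branch_e[of _ u f] u by (auto simp: C'_def C_def)
    qed
    moreover have "?S (C' u \<union> (\<Union>w\<in>e - {u}. C w)) = ?S (C' u) * ?S (\<Union>w\<in>e - {u}. C w)"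
    proof (rule matching_sum_Un)
      show "finite (C' u)" using finC by (simp add: C'_def)
      show "finite (\<Union>w\<in>e - {u}. C w)" using finC e by auto
      show "C' u \<inter> (\<Union>w\<in>e - {u}. C w) = {}"
        using C_Int[OF u] unfolding C'_def by blast
      show "disjnt f g" if "f \<in> C' u" "g \<in> (\<Union>w\<in>e - {u}. C w)" for f g
        using that branch_disj[OF u] by (auto simp: C'_def)
    qed
    moreover have "?S (\<Union>w\<in>e - {u}. C w) = (\<Prod>w\<in>e - {u}. ?S (C w))"
      by (rule matching_sum_UN) (use e finC C_Int branch_disj in auto)
    ultimately show ?thesis by simp
  qed
  have "{f \<in> E - {e}. disjnt e f} = {f \<in> E. disjnt e f}"
    using a by (auto simp: disjnt_iff)
  then have "?S (E - {e}) + z * ?S {f \<in> E. disjnt e f} = 0"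
    using matching_sum_remove[OF fin e(1), of z] zero by simp
  \<comment> \<open>The vanishing of the sum over \<open>E\<close> enters here: it expresses the
    product over full branches by the sum over the edges disjoint from \<open>e\<close>.\<close>
  then have prod_C: "(\<Prod>u\<in>e. ?S (C u)) = - z * ?S {f \<in> E. disjnt e f}"
    unfolding branches SC by (simp add: eq_neg_iff_add_eq_0)
  have "(\<Prod>u\<in>e. ?S {f \<in> E. u \<notin> f}) = (\<Prod>u\<in>e. ?S (C' u)) * (\<Prod>u\<in>e. \<Prod>w\<in>e - {u}. ?S (C w))"
    using delete_vertex by (simp add: prod.distrib)
  also have "\<dots> = ?S {f \<in> E. disjnt e f} * (- z * ?S {f \<in> E. disjnt e f}) ^ (card e - 1)"
    unfolding prod_prod_remove[OF e(2)] prod_C delete_edge SC' ..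
  also have "\<dots> = (- z) ^ (card e - 1) * ?S {f \<in> E. disjnt e f} ^ Suc (card e - 1)"
    unfolding power_mult_distrib by (simp add: mult_ac)
  also have "Suc (card e - 1) = card e"
    using a e(2) by (metis card_gt_0_iff Suc_pred' empty_iff)
  finally show ?thesis .
qed

section \<open>The spectral radius\<close>

lemma card_inj_extensional:
  assumes "finite A" "finite B" "card A = card B"
  shows "card {f \<in> A \<rightarrow>\<^sub>E B. inj_on f A} = fact (card B)"
  using card_inj_on_subset_funcset[of A B A] assms by (simp add: fact_prod_rev)

text \<open>Each edge through \<open>i\<close> arises from the \<open>(r - 1)!\<close> orderings of
  its other vertices, which cancels the factor in the tensor.\<close>

lemma adjacency_tensor_apply:
  fixes x :: "'a \<Rightarrow> complex"
  assumes H: "uniform_hg r H" and r: "r > 0" and i: "i \<in> verts H"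
  shows "(\<Sum>g \<in> {1..<r} \<rightarrow>\<^sub>E verts H. adj_tensor r H (g(0 := i)) * (\<Prod>k\<in>{1..<r}. x (g k)))
    = (\<Sum>e | e \<in> edges H \<and> i \<in> e. \<Prod>u\<in>e - {i}. x u)"
proof -
  let ?P = "{1..<r} \<rightarrow>\<^sub>E verts H"
  let ?c = "1 / of_nat (fact (r - 1)) :: complex"
  let ?h = "\<lambda>g. ?c * (\<Prod>k\<in>{1..<r}. x (g k))"
  define im where "im g = insert i (g ` {1..<r})" for g
  have lessThan_r: "{..<r} = insert 0 {1..<r}" using r by auto
  have im: "(g(0 := i)) ` {..<r} = im g" for g
    unfolding lessThan_r im_def by (auto simp: image_iff)
  have finV: "finite (verts H)" using H by (simp add: uniform_hg_def)
  have finP: "finite ?P" using finV by (intro finite_PiE) auto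
  have "(\<Sum>g\<in>?P. adj_tensor r H (g(0 := i)) * (\<Prod>k\<in>{1..<r}. x (g k)))
      = (\<Sum>g\<in>?P. if im g \<in> edges H then ?h g else 0)"
    unfolding adj_tensor_def im by (intro sum.cong) auto
  also have "\<dots> = (\<Sum>g | g \<in> ?P \<and> im g \<in> edges H. ?h g)"
    by (rule sum.inter_filter[OF finP, symmetric])
  also have "\<dots> = (\<Sum>e | e \<in> edges H \<and> i \<in> e. \<Sum>g | g \<in> {g \<in> ?P. im g \<in> edges H} \<and> im g = e. ?h g)"
    by (rule sum.group[symmetric]) (use finP finite_edges[OF H] in \<open>auto simp: im_def\<close>)
  also have "\<dots> = (\<Sum>e | e \<in> edges H \<and> i \<in> e. \<Prod>u\<in>e - {i}. x u)"
  proof (rule sum.cong)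
    fix e assume "e \<in> {e \<in> edges H. i \<in> e}"
    then have e: "e \<in> edges H" "i \<in> e" "card e = r" "e \<subseteq> verts H" "finite e"
      using H finV by (auto simp: uniform_hg_def intro: finite_subset)
    have card_e: "card (e - {i}) = r - 1" using e by simp
    let ?I = "{g \<in> {1..<r} \<rightarrow>\<^sub>E e - {i}. inj_on g {1..<r}}"
    have onto: "g ` {1..<r} = e - {i}" if "g \<in> ?I" for g
      using that e card_e by (intro card_subset_eq) (auto simp: card_image)
    \<comment> \<open>The \<open>r - 1\<close> entries together with \<open>i\<close> must give
      \<open>r\<close> vertices, so they neither repeat nor hit \<open>i\<close>.\<close>
    have "{g. g \<in> {g \<in> ?P. im g \<in> edges H} \<and> im g = e} = ?I"
    proof (intro equalityI subsetI)
      fix g assume "g \<in> {g. g \<in> {g \<in> ?P. im g \<in> edges H} \<and> im g = e}"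
      then have g: "g \<in> ?P" "im g = e" by auto
      have card_im: "card (g ` {1..<r}) \<le> r - 1" using card_image_le[of "{1..<r}" g] by simp
      have "i \<notin> g ` {1..<r}"
      proof
        assume "i \<in> g ` {1..<r}"
        then have "e = g ` {1..<r}" using g(2) by (auto simp: im_def)
        then show False using card_im e(3) r by simp
      qed
      then have eq: "g ` {1..<r} = e - {i}" using g(2) by (auto simp: im_def)
      then have "inj_on g {1..<r}" using card_e by (intro eq_card_imp_inj_on) auto
      then show "g \<in> ?I" using g(1) eq by (auto simp: PiE_iff)
    next
      fix g assume g: "g \<in> ?I"
      then have "im g = e" using onto[OF g] e(2) by (auto simp: im_def)
      moreover have "g \<in> ?P" using g e(4) by (auto simp: PiE_iff)
      ultimately show "g \<in> {g. g \<in> {g \<in> ?P. im g \<in> edges H} \<and> im g = e}" using e(1) by auto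
    qed
    then have "(\<Sum>g | g \<in> {g \<in> ?P. im g \<in> edges H} \<and> im g = e. ?h g) = (\<Sum>g\<in>?I. ?h g)"
      by (rule arg_cong)
    also have "\<dots> = (\<Sum>g\<in>?I. ?c * (\<Prod>u\<in>e - {i}. x u))"
    proof (rule sum.cong)
      fix g assume g: "g \<in> ?I"
      then have "bij_betw g {1..<r} (e - {i})" using onto[OF g] by (simp add: bij_betw_def)
      then show "?h g = ?c * (\<Prod>u\<in>e - {i}. x u)"
        by (simp add: prod.reindex_bij_betw)
    qed simp
    also have "\<dots> = of_nat (card ?I) * (?c * (\<Prod>u\<in>e - {i}. x u))" by simp
    also have "card ?I = fact (r - 1)"
      using card_inj_extensional[of "{1..<r}" "e - {i}"] e(5) card_e by simp
    finally show "(\<Sum>g | g \<in> {g \<in> ?P. im g \<in> edges H} \<and> im g = e. ?h g) = (\<Prod>u\<in>e - {i}. x u)"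
      by simp
  qed simp
  finally show ?thesis .
qed

lemma tensor_eigenvalue_iff:
  assumes "uniform_hg r H" "r > 0"
  shows "tensor_eigenvalue r H lam \<longleftrightarrow> (\<exists>x. (\<exists>i\<in>verts H. x i \<noteq> 0) \<and>
    (\<forall>i\<in>verts H. (\<Sum>e | e \<in> edges H \<and> i \<in> e. \<Prod>u\<in>e - {i}. x u) = lam * x i ^ (r - 1)))"
  unfolding tensor_eigenvalue_def using adjacency_tensor_apply[OF assms] by simp

text \<open>A Perron-Frobenius comparison: for any eigenvector \<open>y\<close>, the equation at an
  index where \<open>cmod (y i) / x i\<close> is largest bounds the modulus of its eigenvalue by
  \<open>\<rho>\<close>, and \<open>x\<close> itself attains this bound.\<close>

lemma spectral_radius_eqI:
  fixes x :: "'a \<Rightarrow> real"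
  assumes H: "uniform_hg r H" and r: "r > 0" and V: "verts H \<noteq> {}"
    and \<rho>: "\<rho> \<ge> 0" and x: "\<And>i. i \<in> verts H \<Longrightarrow> x i > 0"
    and eig: "\<And>i. i \<in> verts H \<Longrightarrow>
      (\<Sum>e | e \<in> edges H \<and> i \<in> e. \<Prod>u\<in>e - {i}. x u) = \<rho> * x i ^ (r - 1)"
  shows "spectral_radius_hg r H = \<rho>"
  unfolding spectral_radius_hg_def
proof (rule cSup_eq_maximum)
  have "tensor_eigenvalue r H (of_real \<rho>)"
    unfolding tensor_eigenvalue_iff[OF H r]
  proof (intro exI[of _ "\<lambda>i. of_real (x i)"] conjI ballI)
    show "\<exists>i\<in>verts H. complex_of_real (x i) \<noteq> 0" using V x by fastforce
    fix i assume "i \<in> verts H"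
    then show "(\<Sum>e | e \<in> edges H \<and> i \<in> e. \<Prod>u\<in>e - {i}. complex_of_real (x u))
        = of_real \<rho> * of_real (x i) ^ (r - 1)"
      using eig[of i] by (simp flip: of_real_prod of_real_sum of_real_mult of_real_power)
  qed
  then show "\<rho> \<in> {cmod lam |lam. tensor_eigenvalue r H lam}"
    using \<rho> by (intro CollectI exI[of _ "complex_of_real \<rho>"]) simp
next
  fix t assume "t \<in> {cmod lam |lam. tensor_eigenvalue r H lam}"
  then obtain lam y where t: "t = cmod lam" and y0: "\<exists>i\<in>verts H. y i \<noteq> 0"
    and y: "\<And>i. i \<in> verts H \<Longrightarrow>
      (\<Sum>e | e \<in> edges H \<and> i \<in> e. \<Prod>u\<in>e - {i}. y u) = lam * y i ^ (r - 1)"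
    by (auto simp: tensor_eigenvalue_iff[OF H r])
  have finV: "finite (verts H)" using H by (simp add: uniform_hg_def)
  define q where "q i = cmod (y i) / x i" for i
  define m where "m = Max (q ` verts H)"
  have "m \<in> q ` verts H" unfolding m_def using finV V by (intro Max_in) auto
  then obtain i where i: "i \<in> verts H" "m = q i" by auto
  have q_le: "q j \<le> m" if "j \<in> verts H" for j
    unfolding m_def using finV that by (intro Max_ge) auto
  have y_le: "cmod (y j) \<le> m * x j" if "j \<in> verts H" for j
    using q_le[OF that] x[OF that] by (simp add: q_def divide_le_eq)
  obtain j where "j \<in> verts H" "y j \<noteq> 0" using y0 by auto
  then have "m > 0" using q_le[of j] x[of j] by (auto simp: q_def intro: less_le_trans[rotated])
  have yi: "cmod (y i) = m * x i" using i x[of i] by (simp add: q_def)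
  have "t * cmod (y i) ^ (r - 1) = cmod (\<Sum>e | e \<in> edges H \<and> i \<in> e. \<Prod>u\<in>e - {i}. y u)"
    using y[OF i(1)] by (simp add: t norm_mult norm_power)
  also have "\<dots> \<le> (\<Sum>e | e \<in> edges H \<and> i \<in> e. \<Prod>u\<in>e - {i}. cmod (y u))"
    unfolding prod_norm by (rule norm_sum)
  \<comment> \<open>Every entry of \<open>y\<close> is at most \<open>m\<close> times that of
    \<open>x\<close>, with equality at \<open>i\<close>; so the eigenvalue equation of
    \<open>x\<close> turns the bound back into a power of \<open>cmod (y i)\<close>, which is
    positive and cancels.\<close>
  also have "\<dots> \<le> (\<Sum>e | e \<in> edges H \<and> i \<in> e. m ^ (r - 1) * (\<Prod>u\<in>e - {i}. x u))"
  proof (rule sum_mono)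
    fix e assume "e \<in> {e \<in> edges H. i \<in> e}"
    then have e: "i \<in> e" "card e = r" "e \<subseteq> verts H" "finite e"
      using H finV by (auto simp: uniform_hg_def intro: finite_subset)
    have "(\<Prod>u\<in>e - {i}. cmod (y u)) \<le> (\<Prod>u\<in>e - {i}. m * x u)"
      using e y_le by (intro prod_mono) auto
    also have "\<dots> = m ^ (r - 1) * (\<Prod>u\<in>e - {i}. x u)"
      using e by (simp add: prod.distrib)
    finally show "(\<Prod>u\<in>e - {i}. cmod (y u)) \<le> m ^ (r - 1) * (\<Prod>u\<in>e - {i}. x u)" .
  qed
  also have "\<dots> = m ^ (r - 1) * (\<rho> * x i ^ (r - 1))"
    by (simp add: eig[OF i(1)] flip: sum_distrib_left)
  also have "\<dots> = \<rho> * cmod (y i) ^ (r - 1)"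
    by (simp add: yi power_mult_distrib)
  finally show "t \<le> \<rho>"
    using \<open>m > 0\<close> x[OF i(1)] yi by simp
qed

text \<open>A path from \<open>F\<close> to an edge outside cannot leave the vertices of
  \<open>F\<close> if every edge meeting \<open>F\<close> belongs to \<open>F\<close>. This provides
  the connectedness hypothesis of \<open>matching_sum_pos_at_least_zero\<close>.\<close>

lemma connected_edges_meet:
  assumes "\<And>x y. x \<in> \<Union>E \<Longrightarrow> y \<in> \<Union>E \<Longrightarrow> (x, y) \<in> (edge_adj E)\<^sup>*" "{} \<notin> E"
    and F: "F \<subset> E" "F \<noteq> {}"
  shows "\<exists>e\<in>E - F. \<exists>f\<in>F. \<not> disjnt e f"
proof (rule ccontr)
  assume no: "\<not> (\<exists>e\<in>E - F. \<exists>f\<in>F. \<not> disjnt e f)"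
  obtain f where f: "f \<in> F" using F by auto
  then obtain x where x: "x \<in> f" using assms(2) F(1) by (metis all_not_in_conv psubsetD)
  obtain e where e: "e \<in> E - F" using F by auto
  then obtain y where y: "y \<in> e" using assms(2) by (metis DiffD1 all_not_in_conv)
  have "(x, y) \<in> (edge_adj E)\<^sup>*" using assms(1)[of x y] e f x y F(1) by blast
  then have "y \<in> \<Union>F"
  proof (induction rule: rtrancl_induct)
    case (step y z)
    then obtain g where g: "g \<in> E" "y \<in> g" "z \<in> g" by (auto simp: edge_adj_def)
    moreover obtain f where "f \<in> F" "y \<in> f" using step.IH by auto
    ultimately have "g \<in> F" using no by (auto simp: disjnt_iff)
    then show ?case using g by auto
  qed (use x f in auto)
  then show False using no e y by (auto simp: disjnt_iff)
qed

text \<open>For the vector \<open>x\<^sub>v = S(E - v, - a)\<^bsup>1/r\<^esup>\<close> the eigenvalue equation at \<open>v\<close> is the expansion at \<open>v\<close>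
  of the vanishing sum \<open>S(E, - a)\<close>.\<close>

lemma spectral_radius_eq_least_zero:
  assumes H: "uniform_hg r H" and r: "r \<ge> 2" and conn: "hg_connected H"
    and acyc: "acyclic_edges (edges H)" and nonempty: "edges H \<noteq> {}"
    and a: "0 < (a::real)" "matching_sum (edges H) (- a) = 0"
      "\<And>b. 0 \<le> b \<Longrightarrow> b < a \<Longrightarrow> matching_sum (edges H) (- b) > 0"
  shows "spectral_radius_hg r H = root r (1 / a)"
proof -
  let ?E = "edges H"
  let ?S = "\<lambda>E. matching_sum E (- a)"
  have fin: "finite ?E" using finite_edges[OF H] .
  have edge: "e \<subseteq> verts H" "card e = r" "finite e" if "e \<in> ?E" for e
    using H that by (auto simp: uniform_hg_def intro: finite_subset)
  have ne: "{} \<notin> ?E" using edge r by force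
  have conn_V: "(x, y) \<in> (edge_adj ?E)\<^sup>*" if "x \<in> verts H" "y \<in> verts H" for x y
    using conn that by (auto simp: hg_connected_def hg_adj_conv_edge_adj)
  have conn_E: "(x, y) \<in> (edge_adj ?E)\<^sup>*" if "x \<in> \<Union>?E" "y \<in> \<Union>?E" for x y
    using conn_V that edge(1) by blast
  have pos: "?S F > 0" if "F \<subset> ?E" for F
    by (rule matching_sum_pos_at_least_zero[OF fin a(1,3) _ that])
      (use connected_edges_meet[OF conn_E ne] in auto)
  \<comment> \<open>Hence deleting a vertex always loses an edge, and \<open>pos\<close> applies to
    \<open>D v\<close>.\<close>
  have incident: "\<exists>e\<in>?E. v \<in> e" if v: "v \<in> verts H" for v
  proof -
    obtain e y where e: "e \<in> ?E" "y \<in> e" using nonempty ne by (metis all_not_in_conv)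
    show ?thesis
    proof (cases "v = y")
      case False
      have "(v, y) \<in> (edge_adj ?E)\<^sup>*" using conn_V[OF v] e edge(1) by blast
      then obtain z where "(v, z) \<in> edge_adj ?E" using False by (metis converse_rtranclE)
      then show ?thesis by (auto simp: edge_adj_def)
    qed (use e in auto)
  qed
  define D where "D v = ?S {f \<in> ?E. v \<notin> f}" for v
  define N where "N e = ?S {f \<in> ?E. disjnt e f}" for e
  define x where "x v = root r (D v)" for v
  define \<rho> where "\<rho> = root r (1 / a)"
  have \<rho>: "\<rho> > 0" "\<rho> ^ r = 1 / a" using r a(1) by (auto simp: \<rho>_def)
  have D: "D v > 0" if "v \<in> verts H" for v
    unfolding D_def using incident[OF that] by (intro pos) auto
  have N: "N e > 0" if "e \<in> ?E" for e
  proof -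
    have "\<not> disjnt e e" using that ne by (auto simp: disjnt_def)
    then show ?thesis unfolding N_def using that by (intro pos) blast
  qed
  have x: "x v > 0" "x v ^ r = D v" if "v \<in> verts H" for v
    using r D[OF that] by (auto simp: x_def)
  have prod_x: "(\<Prod>u\<in>e. x u) = a * \<rho> * N e" if e: "e \<in> ?E" for e
  proof (rule power_eq_imp_eq_base)
    have "(\<Prod>u\<in>e. x u) ^ r = (\<Prod>u\<in>e. D u)"
      unfolding prod_power_distrib using edge(1)[OF e] x(2) by (intro prod.cong) auto
    also have "\<dots> = a ^ (r - 1) * N e ^ r"
      using prod_matching_sum_delete_vertex[OF fin acyc conn_E ne e edge(3)[OF e] a(2)] edge(2)[OF e]
      by (simp add: D_def N_def)
    \<comment> \<open>Since \<open>\<rho> ^ r = 1 / a\<close>, the right-hand side is an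
      \<open>r\<close>-th power, and nonnegative roots can be taken.\<close>
    also have "a ^ (r - 1) = (a * \<rho>) ^ r"
      using a(1) r by (simp add: power_mult_distrib \<rho>(2) power_diff)
    finally show "(\<Prod>u\<in>e. x u) ^ r = (a * \<rho> * N e) ^ r" by (simp add: power_mult_distrib)
    show "0 \<le> (\<Prod>u\<in>e. x u)" using x edge(1)[OF e] by (intro prod_nonneg) (auto intro: less_imp_le)
    show "0 \<le> a * \<rho> * N e" using a(1) \<rho>(1) N[OF e] by simp
  qed (use r in auto)
  have "spectral_radius_hg r H = \<rho>"
  proof (rule spectral_radius_eqI[OF H, of \<rho> x])
    show "verts H \<noteq> {}" using conn by (simp add: hg_connected_def)
    fix v assume v: "v \<in> verts H"
    \<comment> \<open>Multiplying by \<open>x v\<close> completes each product to the whole edge,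
      where \<open>prod_x\<close> gives its value.\<close>
    have "x v * (\<Sum>e | e \<in> ?E \<and> v \<in> e. \<Prod>u\<in>e - {v}. x u) = (\<Sum>e | e \<in> ?E \<and> v \<in> e. \<Prod>u\<in>e. x u)"
      unfolding sum_distrib_left using edge(3) by (intro sum.cong) (auto simp: prod.remove[of _ v])
    also have "\<dots> = \<rho> * (a * (\<Sum>e | e \<in> ?E \<and> v \<in> e. N e))"
      using prod_x by (simp add: sum_distrib_left mult_ac)
    also have "a * (\<Sum>e | e \<in> ?E \<and> v \<in> e. N e) = D v"
      using matching_sum_vertex_expansion[OF fin, of "- a" v] a(2) by (simp add: D_def N_def)
    also have "D v = x v * x v ^ (r - 1)"
      using x(2)[OF v] r by (simp flip: power_Suc)
    finally have "x v * (\<Sum>e | e \<in> ?E \<and> v \<in> e. \<Prod>u\<in>e - {v}. x u) = x v * (\<rho> * x v ^ (r - 1))"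
      by (simp add: mult_ac)
    then show "(\<Sum>e | e \<in> ?E \<and> v \<in> e. \<Prod>u\<in>e - {v}. x u) = \<rho> * x v ^ (r - 1)"
      using x(1)[OF v] by simp
  qed (use r \<rho> x in auto)
  then show ?thesis by (simp add: \<rho>_def)
qed

text \<open>Without edges there is no zero to work with; the constant vector has eigenvalue
  \<open>0\<close>.\<close>

lemma spectral_radius_no_edges:
  assumes "uniform_hg r H" "hg_connected H" "edges H = {}" "r > 0"
  shows "spectral_radius_hg r H = 0"
  by (rule spectral_radius_eqI[where x = "\<lambda>_. 1"]) (use assms in \<open>auto simp: hg_connected_def\<close>)

text \<open>Detects from the values alone whether there are edges: with an edge present the sum has
  a zero.\<close>

lemma matching_sum_eq_1_iff:
  assumes "finite E"
  shows "(\<forall>b::real. matching_sum E b = 1) \<longleftrightarrow> E = {}"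
proof
  assume all: "\<forall>b::real. matching_sum E b = 1"
  show "E = {}"
  proof (rule ccontr)
    assume "E \<noteq> {}"
    with assms obtain a :: real where "matching_sum E (- a) = 0"
      by (rule matching_sum_least_zero)
    then show False using all by simp
  qed
qed simp

lemma spectral_radius_eq_if_matchings_num_eq:
  fixes G :: "'a hypergraph" and H :: "'b hypergraph"
  assumes G: "uniform_hg r G" "hg_connected G" "acyclic_edges (edges G)"
    and H: "uniform_hg r H" "hg_connected H" "acyclic_edges (edges H)"
    and r: "r \<ge> 2" and eq: "\<And>k. matchings_num G k = matchings_num H k"
  shows "spectral_radius_hg r G = spectral_radius_hg r H"
proof -
  have "poly (matching_sum (edges G) (monom 1 1)) b = poly (matching_sum (edges H) (monom 1 1)) b" for b :: real
    using matching_sum_eqI[OF G(1) H(1) eq] by simp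
  then have S: "matching_sum (edges G) b = matching_sum (edges H) b" for b :: real
    by (simp add: poly_matching_sum poly_monom)
  show ?thesis
  proof (cases "edges G = {}")
    case True
    then have "edges H = {}" using matching_sum_eq_1_iff[OF finite_edges[OF G(1)]] matching_sum_eq_1_iff[OF finite_edges[OF H(1)]] S by simp
    then show ?thesis using True spectral_radius_no_edges[OF G(1,2)] spectral_radius_no_edges[OF H(1,2)] r by simp
  next
    case False
    then have "edges H \<noteq> {}" using matching_sum_eq_1_iff[OF finite_edges[OF G(1)]] matching_sum_eq_1_iff[OF finite_edges[OF H(1)]] S by simp
    moreover obtain a :: real where "0 < a" "matching_sum (edges G) (- a) = 0"
        "\<And>b. 0 \<le> b \<Longrightarrow> b < a \<Longrightarrow> matching_sum (edges G) (- b) > 0"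
      using matching_sum_least_zero[OF finite_edges[OF G(1)] False] by blast
    ultimately show ?thesis
      using spectral_radius_eq_least_zero[OF G(1) r G(2,3) False, of a]
        spectral_radius_eq_least_zero[OF H(1) r H(2,3), of a] S by simp
  qed
qed

section \<open>Coalescence\<close>

text \<open>Names the vertex map that \<open>coalesce\<close> applies to \<open>\<Gamma>\<close>. It
  is injective on the whole type, as only \<open>w\<close> is sent to the \<open>Inl\<close>
  side.\<close>

definition glue :: "'a \<Rightarrow> 'b \<Rightarrow> 'b \<Rightarrow> 'a + 'b" where
  "glue u w x = (if x = w then Inl u else Inr x)"

lemma inj_glue: "inj (glue u w)"
  by (auto simp: inj_def glue_def split: if_splits)

lemma verts_coalesce: "verts (coalesce G u w \<Gamma>) = Inl ` verts G \<union> Inr ` (verts \<Gamma> - {w})"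
  by (simp add: coalesce_def verts_def Let_def)

lemma edges_coalesce: "edges (coalesce G u w \<Gamma>) = (`) Inl ` edges G \<union> (`) (glue u w) ` edges \<Gamma>"
  by (simp add: coalesce_def edges_def Let_def glue_def[abs_def])

lemma glue_in_verts_coalesce: "u \<in> verts G \<Longrightarrow> x \<in> verts \<Gamma> \<Longrightarrow> glue u w x \<in> verts (coalesce G u w \<Gamma>)"
  by (auto simp: glue_def verts_coalesce)

lemma uniform_hg_coalesce:
  assumes "uniform_hg r G" "uniform_hg r \<Gamma>" "u \<in> verts G"
  shows "uniform_hg r (coalesce G u w \<Gamma>)"
  unfolding uniform_hg_def
proof (intro conjI ballI)
  show "finite (verts (coalesce G u w \<Gamma>))"
    using assms by (simp add: verts_coalesce uniform_hg_def)
  fix e assume "e \<in> edges (coalesce G u w \<Gamma>)"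
  then consider f where "f \<in> edges G" "e = Inl ` f" | f where "f \<in> edges \<Gamma>" "e = glue u w ` f"
    by (auto simp: edges_coalesce)
  then have "e \<subseteq> verts (coalesce G u w \<Gamma>) \<and> card e = r"
  proof cases
    case 1
    then show ?thesis using assms(1) by (auto simp: uniform_hg_def verts_coalesce card_image)
  next
    case 2
    then have "f \<subseteq> verts \<Gamma>" "card f = r" using assms(2) by (auto simp: uniform_hg_def)
    then show ?thesis
      using 2(2) glue_in_verts_coalesce[OF assms(3), of _ \<Gamma> w] card_image[OF inj_on_subset[OF inj_glue]]
      by auto
  qed
  then show "e \<subseteq> verts (coalesce G u w \<Gamma>)" "card e = r" by auto
qed

lemma card_verts_coalesce:
  assumes "uniform_hg r G" "uniform_hg r \<Gamma>" "w \<in> verts \<Gamma>"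
  shows "card (verts (coalesce G u w \<Gamma>)) = card (verts G) + (card (verts \<Gamma>) - 1)"
  unfolding verts_coalesce using assms
  by (subst card_Un_disjoint) (auto simp: uniform_hg_def card_image)

text \<open>Edges may also collapse to the single vertex \<open>c\<close>, where the path just
  pauses; this covers the retractions used for acyclicity as well as the embeddings.\<close>

lemma edge_adj_rtrancl_map:
  assumes "(x, y) \<in> (edge_adj E)\<^sup>*"
    and "\<And>e. e \<in> E \<Longrightarrow> h ` e \<in> E' \<or> h ` e \<subseteq> {c}"
  shows "(h x, h y) \<in> (edge_adj E')\<^sup>*"
  using assms(1)
proof (induction rule: rtrancl_induct)
  case (step y z)
  then obtain e where e: "e \<in> E" "y \<in> e" "z \<in> e" by (auto simp: edge_adj_def)
  have "h y = h z \<or> (h y, h z) \<in> edge_adj E'"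
    using assms(2)[OF e(1)]
  proof
    assume "h ` e \<in> E'"
    then show ?thesis using e by (auto simp: edge_adj_def)
  next
    assume "h ` e \<subseteq> {c}"
    then have "h y = c" "h z = c" using e by auto
    then show ?thesis by simp
  qed
  then show ?case using step.IH by (metis rtrancl.rtrancl_into_rtrancl)
qed simp

lemma hg_connected_coalesce:
  assumes G: "hg_connected G" and \<Gamma>: "hg_connected \<Gamma>" and u: "u \<in> verts G" and w: "w \<in> verts \<Gamma>"
  shows "hg_connected (coalesce G u w \<Gamma>)"
proof -
  let ?R = "(edge_adj (edges (coalesce G u w \<Gamma>)))\<^sup>*"
  have root: "(x, Inl u) \<in> ?R" if x: "x \<in> verts (coalesce G u w \<Gamma>)" for x
  proof -
    have "x \<in> Inl ` verts G \<union> glue u w ` verts \<Gamma>"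
      using x unfolding verts_coalesce by (auto simp: glue_def intro: rev_image_eqI)
    then consider y where "y \<in> verts G" "x = Inl y" | y where "y \<in> verts \<Gamma>" "x = glue u w y"
      by blast
    then show ?thesis
    proof cases
      case 1
      then have "(y, u) \<in> (edge_adj (edges G))\<^sup>*"
        using G u by (auto simp: hg_connected_def hg_adj_conv_edge_adj)
      then show ?thesis
        unfolding 1(2) by (rule edge_adj_rtrancl_map) (auto simp: edges_coalesce)
    next
      case 2
      then have "(y, w) \<in> (edge_adj (edges \<Gamma>))\<^sup>*"
        using \<Gamma> w by (auto simp: hg_connected_def hg_adj_conv_edge_adj)
      then have "(glue u w y, glue u w w) \<in> ?R"
        by (rule edge_adj_rtrancl_map) (auto simp: edges_coalesce)
      then show ?thesis by (simp add: 2(2) glue_def)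
    qed
  qed
  have "(x, y) \<in> ?R" if "x \<in> verts (coalesce G u w \<Gamma>)" "y \<in> verts (coalesce G u w \<Gamma>)" for x y
    using root[OF that(1)] sym_edge_adj_rtrancl[OF root[OF that(2)]] by (rule rtrancl_trans)
  moreover have "verts (coalesce G u w \<Gamma>) \<noteq> {}" using u by (auto simp: verts_coalesce)
  ultimately show ?thesis by (simp add: hg_connected_def hg_adj_conv_edge_adj)
qed

text \<open>A path in the coalescence that avoids an edge of one of the two parts is mapped into that
  part by the retraction that sends the other part to the glued vertex.\<close>

lemma acyclic_edges_coalesce:
  assumes G: "acyclic_edges (edges G)" and \<Gamma>: "acyclic_edges (edges \<Gamma>)"
  shows "acyclic_edges (edges (coalesce G u w \<Gamma>))"
  unfolding acyclic_edges_def
proof (intro ballI impI)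
  fix e x y
  assume e: "e \<in> edges (coalesce G u w \<Gamma>)" and x: "x \<in> e" and y: "y \<in> e"
    and path: "(x, y) \<in> (edge_adj (edges (coalesce G u w \<Gamma>) - {e}))\<^sup>*"
  define k where "k = case_sum (\<lambda>a. a) (\<lambda>_::'b. u)"
  define l where "l = case_sum (\<lambda>_::'a. w) (\<lambda>b. b)"
  have k: "k ` Inl ` f = f" "k ` glue u w ` g \<subseteq> {u}" for f g
    by (auto simp: k_def glue_def image_image)
  have l_glue: "l (glue u w b) = b" for b by (simp add: l_def glue_def)
  have l: "l ` glue u w ` g = g" "l ` Inl ` f \<subseteq> {w}" for f g
    by (auto simp: l_glue image_image) (auto simp: l_def)
  from e consider f where "f \<in> edges G" "e = Inl ` f" | g where "g \<in> edges \<Gamma>" "e = glue u w ` g"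
    by (auto simp: edges_coalesce)
  then show "x = y"
  proof cases
    case 1
    obtain a b where ab: "x = Inl a" "a \<in> f" "y = Inl b" "b \<in> f" using x y 1(2) by auto
    have "k ` h \<in> edges G - {f} \<or> k ` h \<subseteq> {u}" if h: "h \<in> edges (coalesce G u w \<Gamma>) - {e}" for h
    proof -
      from h consider f' where "f' \<in> edges G" "h = Inl ` f'" | g where "h = glue u w ` g"
        by (auto simp: edges_coalesce)
      then show ?thesis
      proof cases
        case (1 f')
        then have "f' \<noteq> f" using h \<open>e = Inl ` f\<close> by auto
        then show ?thesis using 1 k(1) by simp
      qed (use k(2) in simp)
    qed
    then have "(k x, k y) \<in> (edge_adj (edges G - {f}))\<^sup>*" by (rule edge_adj_rtrancl_map[OF path])
    then show ?thesis using G 1(1) ab by (auto simp: acyclic_edges_def k_def)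
  next
    case 2
    obtain a b where ab: "x = glue u w a" "a \<in> g" "y = glue u w b" "b \<in> g" using x y 2(2) by auto
    have "l ` h \<in> edges \<Gamma> - {g} \<or> l ` h \<subseteq> {w}" if h: "h \<in> edges (coalesce G u w \<Gamma>) - {e}" for h
    proof -
      from h consider g' where "g' \<in> edges \<Gamma>" "h = glue u w ` g'" | f where "h = Inl ` f"
        by (auto simp: edges_coalesce)
      then show ?thesis
      proof cases
        case (1 g')
        then have "g' \<noteq> g" using h \<open>e = glue u w ` g\<close> by auto
        then show ?thesis using 1 l(1) by simp
      qed (use l(2) in simp)
    qed
    then have "(l x, l y) \<in> (edge_adj (edges \<Gamma> - {g}))\<^sup>*" by (rule edge_adj_rtrancl_map[OF path])
    moreover have "l x = a" "l y = b" using ab l_glue by auto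
    ultimately have "a = b" using \<Gamma> 2(1) ab by (auto simp: acyclic_edges_def)
    then show ?thesis using ab by simp
  qed
qed

section \<open>Matching sums of a coalescence\<close>

lemma uniform_hg_delete_vertex: "uniform_hg r H \<Longrightarrow> uniform_hg r (delete_vertex H v)"
  by (auto simp: uniform_hg_def delete_vertex_def verts_def edges_def)

lemma edges_delete_vertex: "edges (delete_vertex H v) = {e \<in> edges H. v \<notin> e}"
  by (simp add: delete_vertex_def edges_def)

lemma verts_delete_vertex: "verts (delete_vertex H v) = verts H - {v}"
  by (simp add: delete_vertex_def verts_def)

text \<open>The glued vertex \<open>Inl u\<close> is a cut vertex. An edge common to both parts
  would lie inside \<open>{Inl u}\<close>, which \<open>r \<ge> 2\<close> excludes.\<close>

lemma matching_sum_coalesce: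
  assumes G: "uniform_hg r G" and \<Gamma>: "uniform_hg r \<Gamma>" and r: "r \<ge> 2"
  shows "matching_sum (edges (coalesce G u w \<Gamma>)) z
    = matching_sum (edges G) z * matching_sum (edges (delete_vertex \<Gamma> w)) z
      + matching_sum (edges (delete_vertex G u)) z * matching_sum (edges \<Gamma>) z
      - matching_sum (edges (delete_vertex G u)) z * matching_sum (edges (delete_vertex \<Gamma> w)) z"
proof -
  let ?A = "(`) (Inl :: 'a \<Rightarrow> 'a + 'b) ` edges G" and ?B = "(`) (glue u w) ` edges \<Gamma>"
  have cut: "f \<inter> g \<subseteq> {Inl u}" if "f \<in> ?A" "g \<in> ?B" for f g
    using that by (auto simp: glue_def split: if_splits)
  have disj: "?A \<inter> ?B = {}"
  proof (rule equals0I)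
    fix f assume f: "f \<in> ?A \<inter> ?B"
    then have "card f = r" using G by (auto simp: uniform_hg_def card_image)
    moreover have "f \<subseteq> {Inl u}" using cut[of f f] f by auto
    then have "card f \<le> 1" using card_mono[of "{Inl u}" f] by simp
    ultimately show False using r by simp
  qed
  have "{f \<in> ?A. Inl u \<notin> f} = (`) Inl ` edges (delete_vertex G u)"
    by (auto simp: edges_delete_vertex)
  moreover have "{f \<in> ?B. Inl u \<notin> f} = (`) (glue u w) ` edges (delete_vertex \<Gamma> w)"
    by (auto simp: edges_delete_vertex glue_def split: if_splits)
  moreover have "inj_on (Inl :: 'a \<Rightarrow> 'a + 'b) X" "inj_on (glue u w) Y" for X Y
    by (auto intro: inj_on_subset[OF inj_glue])
  ultimately show ?thesis
    using matching_sum_cut_vertex[of ?A ?B "Inl u" z] cut disj finite_edges[OF G] finite_edges[OF \<Gamma>]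
    by (simp add: edges_coalesce matching_sum_image)
qed

theorem theorem1:
  fixes r :: nat
    and G :: "'a hypergraph" and H :: "'c hypergraph" and \<Gamma> :: "'b hypergraph"
    and u :: 'a and v :: 'c
  assumes "r \<ge> 3"
    and "supertree r G" and "supertree r H" and "supertree r \<Gamma>"
    and "card (verts G) = card (verts H)"
    and "u \<in> verts G" and "v \<in> verts H"
    and "matching_poly r G = matching_poly r H"
    and "matching_poly r (delete_vertex G u) = matching_poly r (delete_vertex H v)"
  shows "\<forall>w \<in> verts \<Gamma>.
           spectral_radius_hg r (coalesce G u w \<Gamma>) = spectral_radius_hg r (coalesce H v w \<Gamma>) \<and>
           matching_energy r (coalesce G u w \<Gamma>) = matching_energy r (coalesce H v w \<Gamma>)"
proof
  fix w assume w: "w \<in> verts \<Gamma>"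
  let ?X = "monom 1 1 :: real poly"
  let ?K = "coalesce G u w \<Gamma>" and ?L = "coalesce H v w \<Gamma>"
  have r: "r > 0" "r \<ge> 2" using assms(1) by auto
  have G: "uniform_hg r G" "hg_connected G" "acyclic_edges (edges G)"
    and H: "uniform_hg r H" "hg_connected H" "acyclic_edges (edges H)"
    and \<Gamma>: "uniform_hg r \<Gamma>" "hg_connected \<Gamma>" "acyclic_edges (edges \<Gamma>)"
    using assms(2-4) by (auto simp: supertree_def intro: acyclic_edges_if_no_berge_cycle)
  have K: "uniform_hg r ?K" "hg_connected ?K" "acyclic_edges (edges ?K)"
    and L: "uniform_hg r ?L" "hg_connected ?L" "acyclic_edges (edges ?L)"
    using G H \<Gamma> assms(6,7) w
    by (auto intro: uniform_hg_coalesce hg_connected_coalesce acyclic_edges_coalesce)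
  have "matching_sum (edges G) ?X = matching_sum (edges H) ?X"
    using assms(5,8) G(1) H(1) r(1) by (intro matching_sum_eqI[of r]) (auto simp: matching_poly_eq_iff)
  moreover have "matching_sum (edges (delete_vertex G u)) ?X = matching_sum (edges (delete_vertex H v)) ?X"
  proof (rule matching_sum_eqI)
    have "card (verts (delete_vertex G u)) = card (verts (delete_vertex H v))"
      using assms(5-7) by (simp add: verts_delete_vertex)
    then show "matchings_num (delete_vertex G u) k = matchings_num (delete_vertex H v) k" for k
      using assms(9) G(1) H(1) r(1) by (simp add: matching_poly_eq_iff uniform_hg_delete_vertex)
  qed (use G H in \<open>auto intro: uniform_hg_delete_vertex\<close>)
  \<comment> \<open>The right-hand side of \<open>matching_sum_coalesce\<close> involves
    \<open>G\<close> and \<open>u\<close> only through the two sums just shown to agree.\<close>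
  ultimately have "matching_sum (edges ?K) ?X = matching_sum (edges ?L) ?X"
    using G H \<Gamma> r(2) by (simp only: matching_sum_coalesce)
  then have num: "matchings_num ?K k = matchings_num ?L k" for k
    using coeff_matching_sum[OF finite_edges[OF K(1)], of k] coeff_matching_sum[OF finite_edges[OF L(1)], of k]
    by simp
  \<comment> \<open>The exponents of the matching polynomial depend on the number of vertices as
    well.\<close>
  have "card (verts ?K) = card (verts ?L)"
    using assms(5) G(1) H(1) \<Gamma>(1) w by (simp add: card_verts_coalesce)
  then have "matching_poly r ?K = matching_poly r ?L"
    using K(1) L(1) r(1) num by (simp add: matching_poly_eq_iff)
  moreover have "spectral_radius_hg r ?K = spectral_radius_hg r ?L"
    by (rule spectral_radius_eq_if_matchings_num_eq[OF K L r(2) num])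
  ultimately show "spectral_radius_hg r ?K = spectral_radius_hg r ?L \<and>
      matching_energy r ?K = matching_energy r ?L"
    by (simp add: matching_energy_def)
qed

end
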